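(* There exists $\epsilon_0>0$ such that the following holds for every $0<\epsilon<\epsilon_0$. Let $E\subset\mathbb{R}^2$ be a measurable set with $[0,1]^2\subset E\subset[-\epsilon,1+\epsilon]^2$, and assume that $E$ tiles $\mathbb{R}^2$ by translations. Then $E$ also admits a tiling $E+\Lambda=\mathbb{R}^2$ whose translation set $\Lambda$ is a lattice in $\mathbb{R}^2$.
   Context: A measurable set $E\subset\mathbb{R}^n$ with $0<|E|<\infty$ tiles $\mathbb{R}^n$ by translations if there is a discrete set $T\subset\mathbb{R}^n$ such that, up to sets of measure zero, the sets $E+t$, $t\in T$, are pairwise disjoint and their union is $\mathbb{R}^n$; $T$ is then called a translation set. A lattice in $\mathbb{R}^n$ is a set of the form $A\mathbb{Z}^n$ with $A$ an invertible linear map of $\mathbb{R}^n$. *)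

theory Defs
  imports "HOL-Analysis.Analysis"
begin

definition tiles_by :: "(real^'n) set \<Rightarrow> (real^'n) set \<Rightarrow> bool" where
  "tiles_by E T \<longleftrightarrow>
     E \<in> sets lebesgue \<and> 0 < emeasure lebesgue E \<and> emeasure lebesgue E < \<infinity> \<and>
     discrete T \<and>
     (\<forall>s\<in>T. \<forall>t\<in>T. s \<noteq> t \<longrightarrow>
        ((\<lambda>x. x + s) ` E \<inter> (\<lambda>x. x + t) ` E) \<in> null_sets lebesgue) \<and>
     (UNIV - (\<Union>t\<in>T. (\<lambda>x. x + t) ` E)) \<in> null_sets lebesgue"

definition tiles :: "(real^'n) set \<Rightarrow> bool" where
  "tiles E \<longleftrightarrow> (\<exists>T. tiles_by E T)"

definition is_lattice :: "(real^'n) set \<Rightarrow> bool" where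
  "is_lattice L \<longleftrightarrow> (\<exists>A :: real^'n^'n. invertible A \<and>
      L = (\<lambda>v. A *v v) ` {v. \<forall>i. v $ i \<in> \<int>})"

end

theory Submission
  imports Defs
begin

text \<open>Tiles are separated by at least \<open>1\<close> in the maximum norm, so up to exchanging the coordinates some
  tile \<open>t\<close> has an almost aligned upper neighbour \<open>t + u\<close>; its right neighbour \<open>t + s\<close> whose vertical offset
  is about \<open>1/2\<close> at most then also has an almost aligned upper neighbour \<open>t + s + u'\<close>. Put \<open>v = u' - u\<close>.
  Comparing the gap between \<open>t\<close> and \<open>t + s\<close> with the one between \<open>t + u\<close> and \<open>t + s + u'\<close> shows that \<open>v\<close> is a
  local period of the left edge of \<open>E\<close>. That edge is vertical up to \<open>\<epsilon>\<close>, so \<open>v\<close> is nearly vertical.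
  Comparing the gaps above \<open>t\<close> and above \<open>t + s\<close> in the same way, \<open>v\<close> is nearly horizontal. Hence \<open>v = 0\<close>,
  and four tiles sit at the vertices of a parallelogram spanned by \<open>s\<close> and \<open>u\<close>. They alone cover the
  parallelogram joining their centres, so \<open>E\<close> tiles by the lattice spanned by \<open>s\<close> and \<open>u\<close>.\<close>

section \<open>Rectangles with the two axes in either order\<close>

text \<open>The axes stay an arbitrary pair \<open>i \<noteq> j\<close>, so that arguments below can
  be reused with the axes exchanged.\<close>

lemma all_2_distinct:
  fixes i j :: 2
  assumes "i \<noteq> j"
  shows "(\<forall>k. P k) \<longleftrightarrow> P i \<and> P j"
proof -
  have "k = i \<or> k = j" for k
    using assms exhaust_2[of i] exhaust_2[of j] exhaust_2[of k] by auto
  then show ?thesis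
    by metis
qed

lemma UNIV_2_distinct:
  fixes i j :: 2
  assumes "i \<noteq> j"
  shows "UNIV = {i, j}"
  using all_2_distinct[OF assms, of "\<lambda>k. k \<in> {i, j}"] by auto

text \<open>Half-open, so that cutting along a line gives disjoint pieces with exact union.\<close>

definition rect :: "2 \<Rightarrow> 2 \<Rightarrow> real \<Rightarrow> real \<Rightarrow> real \<Rightarrow> real \<Rightarrow> (real^2) set" where
  "rect i j a b c d = {x. a \<le> x$i \<and> x$i < b \<and> c \<le> x$j \<and> x$j < d}"

lemma rect_lmeasurable_measure:
  assumes ij: "i \<noteq> j" and ab: "a \<le> b" "c \<le> d"
  shows "rect i j a b c d \<in> lmeasurable"
    and "measure lebesgue (rect i j a b c d) = (b - a) * (d - c)"
proof -
  define l where "l = (\<chi> k. if k = i then a else c)"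
  define u where "u = (\<chi> k. if k = i then b else d)"
  have cb: "x \<in> cbox l u \<longleftrightarrow> a \<le> x$i \<and> x$i \<le> b \<and> c \<le> x$j \<and> x$j \<le> d" for x
    using ij by (auto simp: mem_box_cart all_2_distinct[OF ij] l_def u_def)
  have ob: "x \<in> box l u \<longleftrightarrow> a < x$i \<and> x$i < b \<and> c < x$j \<and> x$j < d" for x
    using ij by (auto simp: mem_box_cart all_2_distinct[OF ij] l_def u_def)
  have "(cbox l u - rect i j a b c d) \<union> (rect i j a b c d - cbox l u) \<subseteq> cbox l u - box l u"
    by (auto simp: cb ob rect_def)
  then have neg: "negligible ((cbox l u - rect i j a b c d) \<union> (rect i j a b c d - cbox l u))"
    using negligible_frontier_interval negligible_subset by blast
  show "rect i j a b c d \<in> lmeasurable"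
    by (rule lmeasurable_negligible_symdiff[OF lmeasurable_cbox neg])
  have "l \<in> cbox l u"
    using ab ij unfolding cb by (simp add: l_def)
  then have "measure lebesgue (cbox l u) = (\<Prod>k\<in>UNIV. u$k - l$k)"
    by (subst content_cbox_cart[symmetric]) auto
  also have "\<dots> = (b - a) * (d - c)"
    using ij unfolding UNIV_2_distinct[OF ij] by (simp add: l_def u_def)
  finally show "measure lebesgue (rect i j a b c d) = (b - a) * (d - c)"
    using measure_negligible_symdiff[OF lmeasurable_cbox neg] by simp
qed

lemma mem_translation_iff: "x \<in> (+) v ` C \<longleftrightarrow> x - v \<in> C" for v :: "'a::ab_group_add"
  by (auto intro: rev_image_eqI)

section \<open>Local periods of an almost straight edge\<close>

text \<open>Area count. The edge of \<open>A\<close> lies in a strip of width \<open>e\<close>.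
  Shifting the window by \<open>-v\<close> preserves the area of \<open>A\<close> in it, by
  periodicity. The shift along \<open>i\<close> changes the full part by
  \<open>v$i * (d - c)\<close>, and the strip can compensate only by its end pieces of length
  \<open>\<bar>v$j\<bar>\<close>.\<close>

lemma boundary_shift_bound:
  fixes A :: "(real^2) set" and v :: "real^2"
  assumes ij: "i \<noteq> j" and A: "A \<in> sets lebesgue"
    and lower: "\<And>x. x \<in> A \<Longrightarrow> \<sigma> - e \<le> x$i"
    and full: "\<And>x. \<sigma> \<le> x$i \<Longrightarrow> x$i \<le> b + \<eta> \<Longrightarrow> c - \<eta> \<le> x$j \<Longrightarrow> x$j \<le> d + \<eta> \<Longrightarrow> x \<in> A"
    and period: "negligible {x \<in> rect i j a b c d. x \<in> A \<longleftrightarrow> x - v \<notin> A}"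
    and v: "\<bar>v$i\<bar> \<le> \<eta>" "\<bar>v$j\<bar> \<le> \<eta>"
    and le: "0 \<le> e" "a + \<eta> \<le> \<sigma> - e" "\<sigma> + \<eta> \<le> b" "\<eta> \<le> d - c"
  shows "\<bar>v$i\<bar> * (d - c) \<le> e * \<bar>v$j\<bar>"
proof -
  define M where "M a b c d = measure lebesgue (A \<inter> rect i j a b c d)" for a b c d
  define S where "S c d = M (\<sigma> - e) \<sigma> c d" for c d
  have meas: "A \<inter> rect i j a b c d \<in> lmeasurable" if "a \<le> b" "c \<le> d" for a b c d
    using fmeasurable_Int_fmeasurable[OF rect_lmeasurable_measure(1)[OF ij that] A]
    by (simp only: Int_commute)
  \<comment> \<open>\<open>A\<close> is absent before the strip and fills the window beyond it, so
    only the strip term \<open>S\<close> is unknown.\<close>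
  have M_eq: "M a' b' c' d' = S c' d' + (b' - \<sigma>) * (d' - c')"
    if "a' \<le> \<sigma> - e" "\<sigma> \<le> b'" "b' \<le> b + \<eta>" "c' \<le> d'" "c - \<eta> \<le> c'" "d' \<le> d + \<eta>" for a' b' c' d'
  proof -
    have "A \<inter> rect i j a' b' c' d' = (A \<inter> rect i j (\<sigma> - e) \<sigma> c' d') \<union> rect i j \<sigma> b' c' d'"
    proof (rule set_eqI)
      fix x show "x \<in> A \<inter> rect i j a' b' c' d' \<longleftrightarrow>
          x \<in> (A \<inter> rect i j (\<sigma> - e) \<sigma> c' d') \<union> rect i j \<sigma> b' c' d'"
        using that le(1) lower[of x] full[of x] unfolding rect_def by auto
    qed
    moreover have "(A \<inter> rect i j (\<sigma> - e) \<sigma> c' d') \<inter> rect i j \<sigma> b' c' d' = {}"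
      by (auto simp: rect_def)
    ultimately show ?thesis
      using meas[of "\<sigma> - e" \<sigma> c' d'] rect_lmeasurable_measure[OF ij, of \<sigma> b' c' d'] that le(1)
      by (simp add: M_def S_def measure_Un3)
  qed
  have S_split: "S c' d' = S c' m + S m d'" if "c' \<le> m" "m \<le> d'" for c' m d'
  proof -
    have "A \<inter> rect i j (\<sigma> - e) \<sigma> c' d'
        = (A \<inter> rect i j (\<sigma> - e) \<sigma> c' m) \<union> (A \<inter> rect i j (\<sigma> - e) \<sigma> m d')"
      using that by (auto simp: rect_def)
    moreover have "(A \<inter> rect i j (\<sigma> - e) \<sigma> c' m) \<inter> (A \<inter> rect i j (\<sigma> - e) \<sigma> m d') = {}"
      by (auto simp: rect_def)
    ultimately show ?thesis
      using meas[of "\<sigma> - e" \<sigma> c' m] meas[of "\<sigma> - e" \<sigma> m d'] that le(1)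
      by (simp add: M_def S_def measure_Un3)
  qed
  have S_bound: "0 \<le> S c' d' \<and> S c' d' \<le> e * (d' - c')" if "c' \<le> d'" for c' d'
  proof -
    have "S c' d' \<le> measure lebesgue (rect i j (\<sigma> - e) \<sigma> c' d')"
      unfolding S_def M_def using rect_lmeasurable_measure(1)[OF ij, of "\<sigma> - e" \<sigma> c' d'] meas[of "\<sigma> - e" \<sigma> c' d'] that le(1)
      by (intro measure_mono_fmeasurable) auto
    then show ?thesis
      using rect_lmeasurable_measure(2)[OF ij, of "\<sigma> - e" \<sigma> c' d'] that le(1)
      by (simp add: S_def M_def)
  qed
  have "a \<le> b" "c \<le> d"
    using v le by linarith+
  have "M a b c d = M (a - v$i) (b - v$i) (c - v$j) (d - v$j)"
  proof -
    let ?B = "A \<inter> rect i j a b c d" and ?C = "A \<inter> rect i j (a - v$i) (b - v$i) (c - v$j) (d - v$j)"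
    let ?N = "{x \<in> rect i j a b c d. x \<in> A \<longleftrightarrow> x - v \<notin> A}"
    have "(?B - (+) v ` ?C) \<union> ((+) v ` ?C - ?B) \<subseteq> ?N"
    proof -
      have "x \<in> (+) v ` ?C \<longleftrightarrow> x - v \<in> A \<and> x \<in> rect i j a b c d" for x
        unfolding mem_translation_iff by (auto simp: rect_def)
      then show ?thesis by blast
    qed
    then have "negligible ((?B - (+) v ` ?C) \<union> ((+) v ` ?C - ?B))"
      using period negligible_subset by blast
    from measure_negligible_symdiff[OF meas[OF \<open>a \<le> b\<close> \<open>c \<le> d\<close>] this]
    show ?thesis
      by (simp add: M_def measure_translation)
  qed
  moreover have "M a b c d = S c d + (b - \<sigma>) * (d - c)"
    using v le \<open>c \<le> d\<close> by (intro M_eq) linarith+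
  moreover have "M (a - v$i) (b - v$i) (c - v$j) (d - v$j)
      = S (c - v$j) (d - v$j) + (b - v$i - \<sigma>) * (d - v$j - (c - v$j))"
    using v le \<open>c \<le> d\<close> by (intro M_eq) linarith+
  ultimately have eq: "v$i * (d - c) = S (c - v$j) (d - v$j) - S c d"
    by (simp add: algebra_simps)
  \<comment> \<open>The two intervals overlap because
    \<open>\<bar>v$j\<bar> \<le> \<eta> \<le> d - c\<close>. The common part cancels, and each
    remaining end has area between 0 and \<open>e * \<bar>v$j\<bar>\<close>.\<close>
  have "\<bar>S (c - v$j) (d - v$j) - S c d\<bar> \<le> e * \<bar>v$j\<bar>"
  proof (cases "0 \<le> v$j")
    case True
    then have o: "c - v$j \<le> c" "c \<le> d - v$j" "d - v$j \<le> d"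
      using v le by linarith+
    show ?thesis
      using S_split[OF o(1,2)] S_split[OF o(2,3)] S_bound[OF o(1)] S_bound[OF o(3)] True by (simp; linarith)
  next
    case False
    then have o: "c \<le> c - v$j" "c - v$j \<le> d" "d \<le> d - v$j"
      using v le by linarith+
    show ?thesis
      using S_split[OF o(1,2)] S_split[OF o(2,3)] S_bound[OF o(1)] S_bound[OF o(3)] False by (simp; linarith)
  qed
  then show ?thesis
    using eq \<open>c \<le> d\<close> by (metis abs_mult abs_of_nonneg diff_ge_0_iff_ge)
qed

section \<open>Near-square tilings: separation and neighbours\<close>

locale near_square_tiling =
  fixes E T :: "(real^2) set" and \<epsilon> :: real
  assumes eps: "0 < \<epsilon>" "\<epsilon> < 1/1000"
    and E_meas: "E \<in> lmeasurable"
    and unit_square: "\<And>x. (\<And>k. 0 \<le> x$k \<and> x$k \<le> 1) \<Longrightarrow> x \<in> E"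
    and E_bound: "\<And>x k. x \<in> E \<Longrightarrow> - \<epsilon> \<le> x$k \<and> x$k \<le> 1 + \<epsilon>"
    and packing: "\<And>s t. s \<in> T \<Longrightarrow> t \<in> T \<Longrightarrow> s \<noteq> t \<Longrightarrow> negligible {x. x - s \<in> E \<and> x - t \<in> E}"
    and covering: "negligible {x. \<forall>t\<in>T. x - t \<notin> E}"
begin

text \<open>The unit squares inside the two tiles meet in a nonempty open rectangle, centred at the
  midpoint of the squares' centres.\<close>

lemma not_negligible_overlap:
  assumes ij: "i \<noteq> j" and "\<bar>s$i - t$i\<bar> < 1" "\<bar>s$j - t$j\<bar> < 1"
  shows "\<not> negligible {x. x - s \<in> E \<and> x - t \<in> E}"
proof
  assume neg: "negligible {x. x - s \<in> E \<and> x - t \<in> E}"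
  define U where "U = {x::real^2. max (s$i) (t$i) < x$i \<and> x$i < min (s$i) (t$i) + 1 \<and>
     max (s$j) (t$j) < x$j \<and> x$j < min (s$j) (t$j) + 1}"
  have "x - s \<in> E \<and> x - t \<in> E" if "x \<in> U" for x
  proof -
    have "\<forall>k. 0 \<le> (x - s)$k \<and> (x - s)$k \<le> 1" "\<forall>k. 0 \<le> (x - t)$k \<and> (x - t)$k \<le> 1"
      using that unfolding all_2_distinct[OF ij] by (auto simp: U_def)
    then show ?thesis
      using unit_square by blast
  qed
  then have "U \<subseteq> {x. x - s \<in> E \<and> x - t \<in> E}" by blast
  then have "negligible U"
    using neg negligible_subset by blast
  moreover have "open U"
    unfolding U_def by (intro open_Collect_conj open_Collect_less continuous_intros)
  moreover have "(\<chi> k. (s$k + t$k + 1) / 2) \<in> U"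
    using assms unfolding U_def by (auto simp: field_simps abs_if split: if_splits)
  ultimately show False
    using open_not_negligible by blast
qed

text \<open>The means of identifying an unknown tile with a known one; positions are relative to a
  base tile \<open>t\<close>.\<close>

lemma separated:
  assumes "i \<noteq> j" "t + y \<in> T" "t + z \<in> T" "\<bar>y$i - z$i\<bar> < 1" "\<bar>y$j - z$j\<bar> < 1"
  shows "y = z"
  using packing[of "t + y" "t + z"] not_negligible_overlap[of i j "t + y" "t + z"] assms by force

text \<open>A probe: a nonempty open box is not negligible, so it meets some tile, whose position is
  then confined by \<open>E_bound\<close>.\<close>

lemma covering_tile:
  assumes ij: "i \<noteq> j" and ab: "a < b" "c < d"
  obtains p z where "a < p$i" "p$i < b" "c < p$j" "p$j < d" "t + z \<in> T"
    "- \<epsilon> \<le> p$i - z$i" "p$i - z$i \<le> 1 + \<epsilon>" "- \<epsilon> \<le> p$j - z$j" "p$j - z$j \<le> 1 + \<epsilon>"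
proof -
  define U where "U = {x::real^2. t$i + a < x$i \<and> x$i < t$i + b \<and> t$j + c < x$j \<and> x$j < t$j + d}"
  have "open U"
    unfolding U_def by (intro open_Collect_conj open_Collect_less continuous_intros)
  moreover have "t + (\<chi> k. if k = i then (a + b) / 2 else (c + d) / 2) \<in> U"
    using assms unfolding U_def by (auto simp: field_simps)
  ultimately have "\<not> negligible U"
    using open_not_negligible by blast
  then have "\<not> U \<subseteq> {x. \<forall>t\<in>T. x - t \<notin> E}"
    using covering negligible_subset by blast
  then obtain x s where xs: "x \<in> U" "s \<in> T" "x - s \<in> E"
    by blast
  show ?thesis
    by (rule that[of "x - t" "s - t"])
      (use xs E_bound[OF xs(3), of i] E_bound[OF xs(3), of j] in \<open>auto simp: U_def\<close>)
qed

text \<open>The probe lies just past the edge of \<open>t\<close> at half height, which bounds the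
  offset by about 1/2. With \<open>s$i < 1\<close> the tile would be \<open>t\<close> itself, which
  does not reach the probe.\<close>

lemma side_neighbour:
  assumes ij: "i \<noteq> j" and t: "t \<in> T"
  obtains s where "t + s \<in> T" "1 \<le> s$i" "s$i \<le> 1 + 3*\<epsilon>" "\<bar>s$j\<bar> \<le> 1/2 + 2*\<epsilon>"
proof -
  obtain p s where s: "1 + \<epsilon> < p$i" "p$i < 1 + 2*\<epsilon>" "1/2 < p$j" "p$j < 1/2 + \<epsilon>" "t + s \<in> T"
    "- \<epsilon> \<le> p$i - s$i" "p$i - s$i \<le> 1 + \<epsilon>" "- \<epsilon> \<le> p$j - s$j" "p$j - s$j \<le> 1 + \<epsilon>"
    using covering_tile[OF ij, of "1 + \<epsilon>" "1 + 2*\<epsilon>" "1/2" "1/2 + \<epsilon>" t] eps by auto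
  have "1 \<le> s$i"
  proof (rule ccontr)
    assume "\<not> 1 \<le> s$i"
    then have "s = 0"
      using s t eps by (intro separated[OF ij, of t]) (auto simp: abs_less_iff)
    with s eps show False by auto
  qed
  with s that[of s] show ?thesis
    by (auto simp: abs_le_iff)
qed

text \<open>A side neighbour \<open>s\<close> is either aligned itself or juts out above or below
  \<open>t\<close>. In the latter case it stops the tile just above, respectively below, the nearby
  corner of \<open>t\<close> from being shifted towards \<open>s\<close>.\<close>

lemma aligned_neighbour:
  obtains i j :: 2 and t u where "i \<noteq> j" "t \<in> T" "t + u \<in> T" "\<bar>u$i\<bar> \<le> 5*\<epsilon>" "1 \<le> u$j" "u$j \<le> 1 + 3*\<epsilon>"
proof -
  define i j :: 2 where "i = 1" and "j = 2"
  have ij: "i \<noteq> j" by (simp add: i_def j_def)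
  obtain t where t: "t \<in> T"
    using covering_tile[OF ij, of 0 1 0 1 0] by auto
  obtain s where s: "t + s \<in> T" "1 \<le> s$i" "s$i \<le> 1 + 3*\<epsilon>" "\<bar>s$j\<bar> \<le> 1/2 + 2*\<epsilon>"
    using side_neighbour[OF ij t] by blast
  \<comment> \<open>The tile found by the probe has vertical offset at most
    \<open>1 + 3*\<epsilon>\<close> in absolute value, so beyond the threshold
    \<open>3*\<epsilon>\<close> it is within 1 of \<open>s\<close> vertically.\<close>
  consider "\<bar>s$j\<bar> \<le> 3*\<epsilon>" | "s$j > 3*\<epsilon>" | "s$j < - 3*\<epsilon>"
    by linarith
  then show thesis
  proof cases
    case 1
    with that[of j i t s] ij t s eps show ?thesis by auto
  next
    case 2
    obtain p u where u: "1 - 4*\<epsilon> < p$i" "p$i < 1 - 3*\<epsilon>" "1 + \<epsilon> < p$j" "p$j < 1 + 2*\<epsilon>" "t + u \<in> T"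
      "- \<epsilon> \<le> p$i - u$i" "p$i - u$i \<le> 1 + \<epsilon>" "- \<epsilon> \<le> p$j - u$j" "p$j - u$j \<le> 1 + \<epsilon>"
      using covering_tile[OF ij, of "1 - 4*\<epsilon>" "1 - 3*\<epsilon>" "1 + \<epsilon>" "1 + 2*\<epsilon>" t] eps by auto
    have j: "1 \<le> u$j"
    proof (rule ccontr)
      assume "\<not> 1 \<le> u$j"
      then have "u = 0"
        using u t eps by (intro separated[OF ij, of t]) (auto simp: abs_less_iff)
      with u eps show False by auto
    qed
    have "u$i \<le> 3*\<epsilon>"
    proof (rule ccontr)
      assume "\<not> u$i \<le> 3*\<epsilon>"
      then have "u = s"
        using u s t eps j 2 by (intro separated[OF ij, of t]) (auto simp: abs_less_iff abs_le_iff)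
      with j s eps show False by auto
    qed
    with that[of i j t u] ij t u j eps show ?thesis by auto
  next
    case 3
    obtain p u where u: "1 - 4*\<epsilon> < p$i" "p$i < 1 - 3*\<epsilon>" "- 2*\<epsilon> < p$j" "p$j < - \<epsilon>" "t + u \<in> T"
      "- \<epsilon> \<le> p$i - u$i" "p$i - u$i \<le> 1 + \<epsilon>" "- \<epsilon> \<le> p$j - u$j" "p$j - u$j \<le> 1 + \<epsilon>"
      using covering_tile[OF ij, of "1 - 4*\<epsilon>" "1 - 3*\<epsilon>" "- 2*\<epsilon>" "- \<epsilon>" t] eps by auto
    have j: "u$j \<le> - 1"
    proof (rule ccontr)
      assume "\<not> u$j \<le> - 1"
      then have "u = 0"
        using u t eps by (intro separated[OF ij, of t]) (auto simp: abs_less_iff)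
      with u eps show False by auto
    qed
    have "u$i \<le> 3*\<epsilon>"
    proof (rule ccontr)
      assume "\<not> u$i \<le> 3*\<epsilon>"
      then have "u = s"
        using u s t eps j 3 by (intro separated[OF ij, of t]) (auto simp: abs_less_iff abs_le_iff)
      with j s eps show False by auto
    qed
    \<comment> \<open>The tile found lies below \<open>t\<close>, so it becomes the base tile and
      \<open>t\<close> its upper neighbour.\<close>
    with that[of i j "t + u" "- u"] ij t u j eps show ?thesis by auto
  qed
qed

text \<open>The tile \<open>s + u'\<close> is the one lying just above the tile \<open>s\<close> near its edge facing \<open>0\<close>. It cannot be
  pushed over that edge, because it meets the horizontal strip of \<open>0\<close> or the one of \<open>u\<close>.\<close>

lemma near_parallelogram:
  assumes ij: "i \<noteq> j" and t: "t \<in> T" and u: "t + u \<in> T" "\<bar>u$i\<bar> \<le> 5*\<epsilon>" "1 \<le> u$j" "u$j \<le> 1 + 3*\<epsilon>"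
  obtains s u' where "t + s \<in> T" "1 \<le> s$i" "s$i \<le> 1 + 3*\<epsilon>" "\<bar>s$j\<bar> \<le> 1/2 + 2*\<epsilon>"
    "t + s + u' \<in> T" "\<bar>u'$i\<bar> \<le> 9*\<epsilon>" "1 \<le> u'$j" "u'$j \<le> 1 + 3*\<epsilon>"
proof -
  obtain s where s: "t + s \<in> T" "1 \<le> s$i" "s$i \<le> 1 + 3*\<epsilon>" "\<bar>s$j\<bar> \<le> 1/2 + 2*\<epsilon>"
    using side_neighbour[OF ij t] by blast
  \<comment> \<open>The offset \<open>7*\<epsilon>\<close> gives \<open>w$i > 6*\<epsilon>\<close>,
    which later rules out both \<open>w = 0\<close> and \<open>w = u\<close>.\<close>
  obtain p w where w: "s$i + 7*\<epsilon> < p$i" "p$i < s$i + 8*\<epsilon>" "s$j + 1 + \<epsilon> < p$j" "p$j < s$j + 1 + 2*\<epsilon>"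
    "t + w \<in> T"
    "- \<epsilon> \<le> p$i - w$i" "p$i - w$i \<le> 1 + \<epsilon>" "- \<epsilon> \<le> p$j - w$j" "p$j - w$j \<le> 1 + \<epsilon>"
    using covering_tile[OF ij, of "s$i + 7*\<epsilon>" "s$i + 8*\<epsilon>" "s$j + 1 + \<epsilon>" "s$j + 1 + 2*\<epsilon>" t] eps by auto
  have j: "s$j + 1 \<le> w$j"
  proof (rule ccontr)
    assume "\<not> s$j + 1 \<le> w$j"
    then have "w = s"
      using w s t eps by (intro separated[OF ij, of t]) (auto simp: abs_less_iff)
    with w eps show False by auto
  qed
  \<comment> \<open>Since \<open>\<bar>u$i\<bar> \<le> 5*\<epsilon>\<close>, a smaller
    \<open>w$i\<close> would put \<open>w\<close> within 1 of both \<open>0\<close> and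
    \<open>u\<close> along \<open>i\<close>; its height decides which of them it equals.\<close>
  have "1 - 5*\<epsilon> \<le> w$i"
  proof (rule ccontr)
    assume less: "\<not> 1 - 5*\<epsilon> \<le> w$i"
    have "w = 0" if "w$j < 1"
      using that less w s t eps j
      by (intro separated[OF ij, of t]) (auto simp: abs_less_iff abs_le_iff)
    moreover have "w = u" if "1 \<le> w$j"
      using that less w s u eps j
      by (intro separated[OF ij, of t]) (auto simp: abs_less_iff abs_le_iff)
    moreover have "6*\<epsilon> < w$i"
      using w s eps by linarith
    ultimately show False
      using u eps by fastforce
  qed
  with that[of s "w - s"] s w j eps show ?thesis
    by (auto simp: abs_le_iff algebra_simps)
qed

section \<open>Gaps between neighbours as periods of the edge\<close>

text \<open>The margins \<open>2*\<epsilon>\<close> put any tile reaching the box within 1 of both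
  tiles along \<open>j\<close>, and along \<open>i\<close> it is within 1 of one of them. So no
  third tile reaches the box. The bounds on \<open>s\<close> are loose enough to admit
  \<open>s + v\<close> below.\<close>

lemma gap_between:
  assumes ij: "i \<noteq> j" and t: "t \<in> T" "t + s \<in> T"
    and s: "1 \<le> s$i" "s$i \<le> 1 + 20*\<epsilon>" "\<bar>s$j\<bar> \<le> 6/10"
  shows "negligible {q. 1/2 \<le> q$i \<and> q$i \<le> 3/2 \<and> max 0 (s$j) + 2*\<epsilon> \<le> q$j \<and>
    q$j \<le> min 0 (s$j) + 1 - 2*\<epsilon> \<and> (q \<in> E \<longleftrightarrow> q - s \<in> E)}" (is "negligible ?N")
proof -
  let ?K = "{x. \<forall>t\<in>T. x - t \<notin> E} \<union> {x. x - t \<in> E \<and> x - (t + s) \<in> E}"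
  have "s \<noteq> 0"
    using s by auto
  then have "negligible ?K"
    using covering packing[of t "t + s"] t by auto
  then have "negligible ((+) (- t) ` ?K)"
    by (rule negligible_translation)
  moreover have "q \<in> (+) (- t) ` ?K" if q: "q \<in> ?N" for q
  proof -
    have "t + q \<in> ?K"
    proof (rule ccontr)
      assume "t + q \<notin> ?K"
      then obtain t' where t': "t' \<in> T" "t + q - t' \<in> E" "\<not> (q \<in> E \<and> q - s \<in> E)"
        by (auto simp: algebra_simps)
      then have no: "q \<notin> E" "q - s \<notin> E"
        using q by auto
      define z where "z = t' - t"
      have z: "t + z \<in> T" "q - z \<in> E"
        using t' by (auto simp: z_def algebra_simps)
      have b: "- \<epsilon> \<le> q$i - z$i" "q$i - z$i \<le> 1 + \<epsilon>" "- \<epsilon> \<le> q$j - z$j" "q$j - z$j \<le> 1 + \<epsilon>"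
        using E_bound[OF z(2), of i] E_bound[OF z(2), of j] by auto
      consider "z$i < 1" | "1 \<le> z$i" by linarith
      then show False
      proof cases
        case 1
        then have "z = 0"
          using z t q b eps by (intro separated[OF ij, of t]) (auto simp: abs_less_iff)
        then show False using z no by auto
      next
        case 2
        then have "z = s"
          using z t q b s eps by (intro separated[OF ij, of t]) (auto simp: abs_less_iff)
        then show False using z no by auto
      qed
    qed
    moreover have "q = (+) (- t) (t + q)" by simp
    ultimately show ?thesis by blast
  qed
  ultimately show ?thesis
    using negligible_subset by blast
qed
text \<open>The gap between two neighbouring tiles is filled by these two tiles only, so if \<open>s\<close> and \<open>s + v\<close> are
  both differences of neighbours, then \<open>v\<close> is a local period of the edge of the tile \<open>s\<close>, which is an
  almost straight line perpendicular to the direction \<open>i\<close>.\<close>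

lemma neighbour_difference_bound:
  assumes ij: "i \<noteq> j" and T: "t \<in> T" "t + s \<in> T" "t' \<in> T" "t' + (s + v) \<in> T"
    and s: "1 \<le> s$i" "s$i \<le> 1 + 3*\<epsilon>" "\<bar>s$j\<bar> \<le> 1/2 + 2*\<epsilon>"
    and v: "\<bar>v$i\<bar> \<le> 15*\<epsilon>" "\<bar>v$j\<bar> \<le> 15*\<epsilon>"
  shows "\<bar>v$i\<bar> \<le> 4 * \<epsilon> * \<bar>v$j\<bar>"
proof -
  have s'1: "1 \<le> (s + v)$i"
  proof (rule ccontr)
    assume "\<not> 1 \<le> (s + v)$i"
    then have "s + v = 0"
      using T s v eps by (intro separated[OF ij, of t']) (auto simp: abs_less_iff abs_le_iff)
    then have "s$i + v$i = 0"
      by (metis vector_add_component zero_index)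
    then show False
      using s v eps by linarith
  qed
  have s': "(s + v)$i \<le> 1 + 20*\<epsilon>" "\<bar>(s + v)$j\<bar> \<le> 6/10"
    using s v eps abs_triangle_ineq[of "s$j" "v$j"] unfolding vector_add_component abs_le_iff by linarith+
  \<comment> \<open>The margin \<open>30*\<epsilon>\<close> absorbs a shift by \<open>v\<close>, at
    most \<open>15*\<epsilon>\<close> per coordinate, together with the margins of
    \<open>gap_between\<close>.\<close>
  define c d where "c = max 0 (s$j) + 30*\<epsilon>" and "d = min 0 (s$j) + 1 - 30*\<epsilon>"
  define A where "A = (+) s ` E"
  have A: "x \<in> A \<longleftrightarrow> x - s \<in> E" for x
    unfolding A_def by (rule mem_translation_iff)
  have "negligible {x \<in> rect i j (1/2) (3/2) c d. x \<in> A \<longleftrightarrow> x - v \<notin> A}"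
  proof (rule negligible_subset)
    let ?N = "\<lambda>s. {q. 1/2 \<le> q$i \<and> q$i \<le> 3/2 \<and> max 0 (s$j) + 2*\<epsilon> \<le> q$j \<and>
      q$j \<le> min 0 (s$j) + 1 - 2*\<epsilon> \<and> (q \<in> E \<longleftrightarrow> q - s \<in> E)}"
    show "negligible (?N s \<union> ?N (s + v))"
      using gap_between[OF ij, of t s] gap_between[OF ij, of t' "s + v"] T s s' s'1 eps
      by (intro negligible_Un) auto
    show "{x \<in> rect i j (1/2) (3/2) c d. x \<in> A \<longleftrightarrow> x - v \<notin> A} \<subseteq> ?N s \<union> ?N (s + v)"
    proof
      fix x assume x: "x \<in> {x \<in> rect i j (1/2) (3/2) c d. x \<in> A \<longleftrightarrow> x - v \<notin> A}"
      \<comment> \<open>Off the two exceptional sets, \<open>s + E\<close> and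
        \<open>s + v + E\<close> both coincide with the complement of \<open>E\<close>, hence with
        each other.\<close>
      then have "(x \<in> E \<longleftrightarrow> x - s \<in> E) \<or> (x \<in> E \<longleftrightarrow> x - (s + v) \<in> E)"
        by (auto simp: A algebra_simps)
      moreover have "1/2 \<le> x$i" "x$i \<le> 3/2" "max 0 (s$j) + 2*\<epsilon> \<le> x$j" "x$j \<le> min 0 (s$j) + 1 - 2*\<epsilon>"
        "max 0 ((s + v)$j) + 2*\<epsilon> \<le> x$j" "x$j \<le> min 0 ((s + v)$j) + 1 - 2*\<epsilon>"
        using x v eps by (auto simp: rect_def c_def d_def abs_le_iff)
      ultimately show "x \<in> ?N s \<union> ?N (s + v)"
        by blast
    qed
  qed
  moreover have "A \<in> sets lebesgue"
    using E_meas lebesgue_sets_translation A_def by blast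
  moreover have "s$i - \<epsilon> \<le> x$i" if "x \<in> A" for x
    using E_bound[of "x - s" i] that A by auto
  moreover have "x \<in> A"
    if "s$i \<le> x$i" "x$i \<le> 3/2 + 15*\<epsilon>" "c - 15*\<epsilon> \<le> x$j" "x$j \<le> d + 15*\<epsilon>" for x
  proof -
    have "\<forall>k. 0 \<le> (x - s)$k \<and> (x - s)$k \<le> 1"
      using that s eps unfolding all_2_distinct[OF ij] by (auto simp: c_def d_def)
    then show ?thesis
      using A unit_square by blast
  qed
  \<comment> \<open>This length is the source of the factor 4 in the claim.\<close>
  moreover have len: "1/4 \<le> d - c"
    using s eps by (auto simp: c_def d_def)
  ultimately have "\<bar>v$i\<bar> * (d - c) \<le> \<epsilon> * \<bar>v$j\<bar>"
    using s v eps by (intro boundary_shift_bound[OF ij, where A = A and \<sigma> = "s$i" and a = "1/2"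
      and b = "3/2" and \<eta> = "15*\<epsilon>"]) auto
  moreover have "\<bar>v$i\<bar> * (1/4) \<le> \<bar>v$i\<bar> * (d - c)"
    using len by (intro mult_left_mono) auto
  ultimately show ?thesis by linarith
qed

section \<open>Four tiles at the vertices of a parallelogram\<close>

lemma parallelogram:
  obtains i j :: 2 and t s u where "i \<noteq> j" "t \<in> T" "t + u \<in> T" "t + s \<in> T" "t + (s + u) \<in> T"
    "\<bar>u$i\<bar> \<le> 5*\<epsilon>" "1 \<le> u$j" "u$j \<le> 1 + 3*\<epsilon>" "1 \<le> s$i" "s$i \<le> 1 + 3*\<epsilon>" "\<bar>s$j\<bar> \<le> 1/2 + 2*\<epsilon>"
proof -
  obtain i j :: 2 and t u where ij: "i \<noteq> j" and
    u: "t \<in> T" "t + u \<in> T" "\<bar>u$i\<bar> \<le> 5*\<epsilon>" "1 \<le> u$j" "u$j \<le> 1 + 3*\<epsilon>"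
    using aligned_neighbour by blast
  obtain s u' where s: "t + s \<in> T" "1 \<le> s$i" "s$i \<le> 1 + 3*\<epsilon>" "\<bar>s$j\<bar> \<le> 1/2 + 2*\<epsilon>"
    "t + s + u' \<in> T" "\<bar>u'$i\<bar> \<le> 9*\<epsilon>" "1 \<le> u'$j" "u'$j \<le> 1 + 3*\<epsilon>"
    using near_parallelogram[OF ij u] by blast
  define v where "v = u' - u"
  have v: "\<bar>v$i\<bar> \<le> 15*\<epsilon>" "\<bar>v$j\<bar> \<le> 15*\<epsilon>"
    using u s eps by (auto simp: v_def)
  \<comment> \<open>The tiles \<open>t + u\<close> and \<open>t + s + u'\<close> differ by
    \<open>s + v\<close>.\<close>
  have vi: "\<bar>v$i\<bar> \<le> 4 * \<epsilon> * \<bar>v$j\<bar>"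
    using neighbour_difference_bound[OF ij, of t s "t + u" v] u s v
    by (simp add: v_def algebra_simps)
  \<comment> \<open>With the axes exchanged: \<open>t + s\<close> and \<open>t + s + u'\<close>
    differ by \<open>u + v\<close>.\<close>
  have vj: "\<bar>v$j\<bar> \<le> 4 * \<epsilon> * \<bar>v$i\<bar>"
    using neighbour_difference_bound[OF ij[symmetric], of t u "t + s" v] u s v eps
    by (simp add: v_def algebra_simps)
  \<comment> \<open>Each coordinate of \<open>v\<close> is at most half the other in absolute value,
    so both vanish.\<close>
  have "4 * \<epsilon> * \<bar>v$j\<bar> \<le> 1/2 * \<bar>v$j\<bar>" "4 * \<epsilon> * \<bar>v$i\<bar> \<le> 1/2 * \<bar>v$i\<bar>"
    using eps by (intro mult_right_mono; simp)+
  with vi vj have "v$i = 0 \<and> v$j = 0"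
    by linarith
  then have "\<forall>k. v$k = 0"
    unfolding all_2_distinct[OF ij] .
  then have "u' = u"
    by (simp add: v_def vec_eq_iff)
  then show thesis
    using that[of i j t u s] ij u s by (simp add: add.assoc)
qed

text \<open>\<open>vec (1/2)\<close> is the centre of the unit square, so the point ranges over the
  parallelogram of the four centres. A tile covering it is within 1 of one of the four in both
  coordinates.\<close>

lemma tile_of_parallelogram:
  assumes ij: "i \<noteq> j" and T: "t \<in> T" "t + u \<in> T" "t + s \<in> T" "t + (s + u) \<in> T"
    and u: "\<bar>u$i\<bar> \<le> 5*\<epsilon>" "1 \<le> u$j" "u$j \<le> 1 + 3*\<epsilon>"
    and s: "1 \<le> s$i" "s$i \<le> 1 + 3*\<epsilon>" "\<bar>s$j\<bar> \<le> 1/2 + 2*\<epsilon>"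
    and \<alpha>: "0 \<le> \<alpha>" "\<alpha> \<le> 1" and \<beta>: "0 \<le> \<beta>" "\<beta> \<le> 1"
    and z: "t + z \<in> T" "vec (1/2) + \<beta> *\<^sub>R s + \<alpha> *\<^sub>R u - z \<in> E"
  shows "z \<in> {0, u, s, s + u}"
proof -
  have au: "\<bar>\<alpha> * u$i\<bar> \<le> 5*\<epsilon>" "0 \<le> \<alpha> * u$j" "\<alpha> * u$j \<le> 1 + 3*\<epsilon>"
  proof -
    have "\<bar>\<alpha>\<bar> * \<bar>u$i\<bar> \<le> 1 * (5*\<epsilon>)"
      using \<alpha> u by (intro mult_mono) auto
    then show "\<bar>\<alpha> * u$i\<bar> \<le> 5*\<epsilon>"
      by (simp add: abs_mult)
    have "\<alpha> * u$j \<le> 1 * (1 + 3*\<epsilon>)"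
      using \<alpha> u by (intro mult_mono) auto
    then show "\<alpha> * u$j \<le> 1 + 3*\<epsilon>" by simp
  qed (use \<alpha> u in auto)
  have bs: "\<beta> \<le> \<beta> * s$i" "\<beta> * s$i \<le> \<beta> + 3*\<epsilon>"
    "\<bar>\<beta> * s$j\<bar> \<le> 51/100 * \<beta>" "\<bar>s$j - \<beta> * s$j\<bar> \<le> 51/100 * (1 - \<beta>)"
  proof -
    have "\<beta> * (s$i - 1) \<le> 1 * (3*\<epsilon>)" "0 \<le> \<beta> * (s$i - 1)"
      using \<beta> s eps by (intro mult_mono mult_nonneg_nonneg; linarith)+
    then show "\<beta> \<le> \<beta> * s$i" "\<beta> * s$i \<le> \<beta> + 3*\<epsilon>"
      by (simp_all add: algebra_simps)
    have le: "\<bar>s$j\<bar> \<le> 51/100"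
      using s eps by linarith
    have "\<bar>\<beta>\<bar> * \<bar>s$j\<bar> \<le> \<beta> * (51/100)"
      using \<beta> le by (intro mult_mono) auto
    then show "\<bar>\<beta> * s$j\<bar> \<le> 51/100 * \<beta>"
      by (simp add: abs_mult)
    have "\<bar>1 - \<beta>\<bar> * \<bar>s$j\<bar> \<le> (1 - \<beta>) * (51/100)"
      using \<beta> le by (intro mult_mono) auto
    then show "\<bar>s$j - \<beta> * s$j\<bar> \<le> 51/100 * (1 - \<beta>)"
      by (simp add: abs_mult[symmetric] algebra_simps)
  qed
  have zi: "- \<epsilon> \<le> 1/2 + \<beta> * s$i + \<alpha> * u$i - z$i" "1/2 + \<beta> * s$i + \<alpha> * u$i - z$i \<le> 1 + \<epsilon>"
    and zj: "- \<epsilon> \<le> 1/2 + \<beta> * s$j + \<alpha> * u$j - z$j" "1/2 + \<beta> * s$j + \<alpha> * u$j - z$j \<le> 1 + \<epsilon>"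
    using E_bound[OF z(2), of i] E_bound[OF z(2), of j] by simp_all
  \<comment> \<open>Up to small errors \<open>z$i\<close> is within 1/2 of \<open>\<beta>\<close>.
    The first case compares with the column \<open>0\<close>, \<open>u\<close>, the second with
    \<open>s\<close>, \<open>s + u\<close>; the bound on \<open>\<beta>\<close> keeps the vertical
    drift along \<open>s\<close> near 0.31.\<close>
  consider "\<beta> \<le> 6/10" "z$i < 1 - 5*\<epsilon>" | "4/10 \<le> \<beta>" "10*\<epsilon> \<le> z$i"
    using zi bs au eps by linarith
  then show ?thesis
  proof cases
    case 1
    have zi': "\<bar>z$i\<bar> < 1" "\<bar>z$i - u$i\<bar> < 1"
      using 1 zi bs au u eps by linarith+
    have zj': "- 9/10 \<le> z$j" "z$j \<le> 19/10"
      using 1 zj bs au eps by linarith+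
    show ?thesis
    proof (cases "z$j < 1")
      case True
      then have "z = 0"
        using zi' zj' T z by (intro separated[OF ij, of t]) auto
      then show ?thesis by simp
    next
      case False
      then have "z = u"
        using zi' zj' T z u eps by (intro separated[OF ij, of t]) auto
      then show ?thesis by simp
    qed
  next
    case 2
    have zi': "\<bar>z$i - s$i\<bar> < 1" "\<bar>z$i - (s + u)$i\<bar> < 1"
      using 2 zi bs au s u \<beta> eps unfolding vector_add_component by linarith+
    have "51/100 * (1 - \<beta>) \<le> 31/100"
      using 2 by simp
    with bs(4) have "\<bar>s$j - \<beta> * s$j\<bar> \<le> 31/100"
      by (rule order_trans)
    note abs_le_D1[OF this] abs_le_D2[OF this]
    then have zj': "- 9/10 \<le> z$j - s$j" "z$j - s$j \<le> 19/10"
      using zj au(2,3) eps by linarith+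
    show ?thesis
    proof (cases "z$j - s$j < 1")
      case True
      then have "z = s"
        using zi' zj' T z by (intro separated[OF ij, of t]) auto
      then show ?thesis by simp
    next
      case False
      then have "z = s + u"
        using zi' zj' T z u eps by (intro separated[OF ij, of t]) auto
      then show ?thesis by simp
    qed
  qed
qed

section \<open>Packing and covering by the lattice\<close>

text \<open>Diagonal dominance: \<open>\<bar>m\<bar>\<close> and \<open>\<bar>n\<bar>\<close> bound
  each other with factors 1/100 and 51/100, so both are below 2. The bound
  \<open>1 + 2*\<epsilon>\<close> is the largest possible extent of \<open>E\<close> along an
  axis.\<close>

lemma short_lattice_vector:
  fixes m n :: int
  assumes u: "\<bar>u$i\<bar> \<le> 5*\<epsilon>" "1 \<le> u$j" and s: "1 \<le> s$i" "\<bar>s$j\<bar> \<le> 1/2 + 2*\<epsilon>"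
    and short: "\<bar>(m *\<^sub>R s + n *\<^sub>R u)$i\<bar> \<le> 1 + 2*\<epsilon>" "\<bar>(m *\<^sub>R s + n *\<^sub>R u)$j\<bar> \<le> 1 + 2*\<epsilon>"
  shows "\<bar>m\<bar> \<le> 1" "\<bar>n\<bar> \<le> 1"
proof -
  have nu: "\<bar>n * u$i\<bar> \<le> 1/100 * \<bar>real_of_int n\<bar>"
  proof -
    have "\<bar>real_of_int n\<bar> * \<bar>u$i\<bar> \<le> \<bar>real_of_int n\<bar> * (1/100)"
      using u eps by (intro mult_left_mono) auto
    then show ?thesis by (simp add: abs_mult)
  qed
  have ms: "\<bar>m * s$j\<bar> \<le> 51/100 * \<bar>real_of_int m\<bar>"
  proof -
    have "\<bar>real_of_int m\<bar> * \<bar>s$j\<bar> \<le> \<bar>real_of_int m\<bar> * (51/100)"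
      using s eps by (intro mult_left_mono) auto
    then show ?thesis by (simp add: abs_mult)
  qed
  have msi: "\<bar>real_of_int m\<bar> \<le> \<bar>m * s$i\<bar>"
  proof -
    have "\<bar>real_of_int m\<bar> * 1 \<le> \<bar>real_of_int m\<bar> * \<bar>s$i\<bar>"
      using s by (intro mult_left_mono) auto
    then show ?thesis by (simp add: abs_mult)
  qed
  have nuj: "\<bar>real_of_int n\<bar> \<le> \<bar>n * u$j\<bar>"
  proof -
    have "\<bar>real_of_int n\<bar> * 1 \<le> \<bar>real_of_int n\<bar> * \<bar>u$j\<bar>"
      using u by (intro mult_left_mono) auto
    then show ?thesis by (simp add: abs_mult)
  qed
  have sh: "\<bar>m * s$i + n * u$i\<bar> \<le> 1 + 2*\<epsilon>" "\<bar>m * s$j + n * u$j\<bar> \<le> 1 + 2*\<epsilon>"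
    using short by simp_all
  have "\<bar>real_of_int m\<bar> \<le> 1 + 2*\<epsilon> + 1/100 * \<bar>real_of_int n\<bar>"
    using abs_triangle_ineq2[of "m * s$i" "- (n * u$i)"] sh(1) nu msi by simp
  moreover have "\<bar>real_of_int n\<bar> \<le> 1 + 2*\<epsilon> + 51/100 * \<bar>real_of_int m\<bar>"
    using abs_triangle_ineq2[of "n * u$j" "- (m * s$j)"] sh(2) ms nuj by (simp add: add.commute)
  ultimately have "\<bar>real_of_int m\<bar> < 2" "\<bar>real_of_int n\<bar> < 2"
    using eps by linarith+
  then show "\<bar>m\<bar> \<le> 1" "\<bar>n\<bar> \<le> 1"
    by linarith+
qed

lemma negligible_overlap_translate:
  assumes "t + y \<in> T" "t + z \<in> T" "y \<noteq> z"
  shows "negligible {x. x \<in> E \<and> x - (z - y) \<in> E}"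
proof -
  have "negligible ((+) (- (t + y)) ` {x. x - (t + y) \<in> E \<and> x - (t + z) \<in> E})"
    using packing[of "t + y" "t + z"] assms by (intro negligible_translation) auto
  moreover have "{x. x \<in> E \<and> x - (z - y) \<in> E} \<subseteq> (+) (- (t + y)) ` {x. x - (t + y) \<in> E \<and> x - (t + z) \<in> E}"
  proof
    fix x assume "x \<in> {x. x \<in> E \<and> x - (z - y) \<in> E}"
    then have "(t + y) + x \<in> {x. x - (t + y) \<in> E \<and> x - (t + z) \<in> E}"
      by (simp add: algebra_simps)
    moreover have "x = (+) (- (t + y)) ((t + y) + x)" by simp
    ultimately show "x \<in> (+) (- (t + y)) ` {x. x - (t + y) \<in> E \<and> x - (t + z) \<in> E}"
      by (rule rev_image_eqI)
  qed
  ultimately show ?thesis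
    using negligible_subset by blast
qed

text \<open>Only coefficients in -1, 0, 1 allow an overlap, and the eight nonzero vectors they give
  are exactly the differences among the four known tiles.\<close>

lemma lattice_packing:
  fixes m n :: int
  assumes T: "t \<in> T" "t + u \<in> T" "t + s \<in> T" "t + (s + u) \<in> T"
    and u: "\<bar>u$i\<bar> \<le> 5*\<epsilon>" "1 \<le> u$j" and s: "1 \<le> s$i" "\<bar>s$j\<bar> \<le> 1/2 + 2*\<epsilon>"
    and nz: "(m, n) \<noteq> (0, 0)"
  shows "negligible {x. x \<in> E \<and> x - (m *\<^sub>R s + n *\<^sub>R u) \<in> E}"
proof (cases "{x. x \<in> E \<and> x - (m *\<^sub>R s + n *\<^sub>R u) \<in> E} = {}")
  case True
  then show ?thesis by (metis negligible_empty)
next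
  case False
  then obtain x where x: "x \<in> E" "x - (m *\<^sub>R s + n *\<^sub>R u) \<in> E"
    by blast
  have "\<bar>(m *\<^sub>R s + n *\<^sub>R u)$k\<bar> \<le> 1 + 2*\<epsilon>" for k
    using E_bound[OF x(1), of k] E_bound[OF x(2), of k] by (simp only: vector_minus_component) linarith
  then have "\<bar>m\<bar> \<le> 1" "\<bar>n\<bar> \<le> 1"
    using short_lattice_vector[OF u s] by blast+
  then have "m \<in> {-1, 0, 1}" "n \<in> {-1, 0, 1}"
    by auto
  have "s$i \<noteq> 0" "u$j \<noteq> 0" "(s + u)$i \<noteq> 0" "s$i \<noteq> u$i"
    using s u eps by auto
  then have neq: "s \<noteq> 0" "u \<noteq> 0" "s + u \<noteq> 0" "s \<noteq> u"
    by (metis zero_index)+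
  have T0: "t + 0 \<in> T" using T by simp
  note ov = negligible_overlap_translate
  show ?thesis
    using \<open>m \<in> _\<close> \<open>n \<in> _\<close> nz neq
      ov[OF T0 T(3)] ov[OF T(3) T0] ov[OF T0 T(2)] ov[OF T(2) T0]
      ov[OF T0 T(4)] ov[OF T(4) T0] ov[OF T(2) T(3)] ov[OF T(3) T(2)]
    by (auto simp: algebra_simps)
qed

text \<open>A lattice translation moves \<open>x\<close> into the parallelogram of centres, where
  only the four lattice-positioned tiles can cover it. The exceptions lie in countably many
  translates of the null set left uncovered by \<open>T\<close>.\<close>

lemma lattice_covering:
  assumes ij: "i \<noteq> j" and T: "t \<in> T" "t + u \<in> T" "t + s \<in> T" "t + (s + u) \<in> T"
    and u: "\<bar>u$i\<bar> \<le> 5*\<epsilon>" "1 \<le> u$j" "u$j \<le> 1 + 3*\<epsilon>"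
    and s: "1 \<le> s$i" "s$i \<le> 1 + 3*\<epsilon>" "\<bar>s$j\<bar> \<le> 1/2 + 2*\<epsilon>"
  shows "negligible {x. \<forall>(m::int) (n::int). x - (m *\<^sub>R s + n *\<^sub>R u) \<notin> E}"
proof (rule negligible_subset)
  let ?K = "{x. \<forall>t\<in>T. x - t \<notin> E}"
  let ?f = "\<lambda>(m::int, n::int). (+) (m *\<^sub>R s + n *\<^sub>R u - t) ` ?K"
  show "negligible (\<Union>(range ?f))"
    using covering by (intro negligible_countable_Union) (auto intro!: negligible_translation)
  define D where "D = s$i * u$j - s$j * u$i"
  have D: "D > 0"
  proof -
    have "\<bar>s$j\<bar> * \<bar>u$i\<bar> \<le> 1 * (1/2)"
      using s u eps by (intro mult_mono) auto
    moreover have "1 * 1 \<le> s$i * u$j"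
      using s u by (intro mult_mono) auto
    ultimately show ?thesis
      unfolding D_def abs_mult[symmetric] by linarith
  qed
  show "{x. \<forall>(m::int) (n::int). x - (m *\<^sub>R s + n *\<^sub>R u) \<notin> E} \<subseteq> \<Union>(range ?f)"
  proof
    fix x assume x: "x \<in> {x. \<forall>(m::int) (n::int). x - (m *\<^sub>R s + n *\<^sub>R u) \<notin> E}"
    define w where "w = x - vec (1/2)"
    \<comment> \<open>Cramer's rule for the coordinates of \<open>w\<close> in the basis
      \<open>s\<close>, \<open>u\<close>.\<close>
    define b a where "b = (w$i * u$j - w$j * u$i) / D" and "a = (s$i * w$j - s$j * w$i) / D"
    have "w$i = b * s$i + a * u$i" "w$j = b * s$j + a * u$j"
    proof -
      have bD: "b * D = w$i * u$j - w$j * u$i" and aD: "a * D = s$i * w$j - s$j * w$i"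
        using D by (simp_all add: a_def b_def)
      have "(b * D) * s$i + (a * D) * u$i = D * w$i" "(b * D) * s$j + (a * D) * u$j = D * w$j"
        unfolding bD aD by (simp_all add: D_def algebra_simps)
      then have "D * (b * s$i + a * u$i) = D * w$i" "D * (b * s$j + a * u$j) = D * w$j"
        by (simp_all add: algebra_simps)
      then show "w$i = b * s$i + a * u$i" "w$j = b * s$j + a * u$j"
        using D by simp_all
    qed
    then have "\<forall>k. w$k = (b *\<^sub>R s + a *\<^sub>R u)$k"
      unfolding all_2_distinct[OF ij] by simp
    then have w: "w = b *\<^sub>R s + a *\<^sub>R u"
      by (simp add: vec_eq_iff)
    define p where "p = vec (1/2) + frac b *\<^sub>R s + frac a *\<^sub>R u"
    have p: "x = p + (\<lfloor>b\<rfloor> *\<^sub>R s + \<lfloor>a\<rfloor> *\<^sub>R u)"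
    proof -
      have "x = vec (1/2) + w"
        by (simp add: w_def)
      then show ?thesis
        by (simp add: w p_def frac_def algebra_simps)
    qed
    have "t + p \<in> ?K"
    proof (rule ccontr)
      assume "t + p \<notin> ?K"
      then obtain t' where t': "t' \<in> T" "t + p - t' \<in> E" by blast
      define z where "z = t' - t"
      have z: "t + z \<in> T" "p - z \<in> E"
        using t' by (auto simp: z_def algebra_simps)
      have "z \<in> {0, u, s, s + u}"
        using z frac_lt_1[of a] frac_lt_1[of b] unfolding p_def
        by (intro tile_of_parallelogram[OF ij T u s, of "frac a" "frac b"]) auto
      then obtain m n :: int where mn: "z = m *\<^sub>R s + n *\<^sub>R u"
        using that
        by (elim insertE emptyE) (metis add_0 add_0_right scaleR_one scaleR_zero_left of_int_0 of_int_1)+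
      have "x - (of_int (m + \<lfloor>b\<rfloor>) *\<^sub>R s + of_int (n + \<lfloor>a\<rfloor>) *\<^sub>R u) = p - z"
        by (simp add: p mn algebra_simps)
      then have "x - (of_int (m + \<lfloor>b\<rfloor>) *\<^sub>R s + of_int (n + \<lfloor>a\<rfloor>) *\<^sub>R u) \<in> E"
        using z by (simp only:)
      then show False
        using x by blast
    qed
    moreover have "x = (\<lfloor>b\<rfloor> *\<^sub>R s + \<lfloor>a\<rfloor> *\<^sub>R u - t) + (t + p)"
      by (simp add: p)
    ultimately show "x \<in> \<Union>(range ?f)"
      by blast
  qed
qed

section \<open>The resulting lattice tiling\<close>

lemma uniform_discrete_if_overlaps_negligible:
  assumes "\<And>x y. x \<in> L \<Longrightarrow> y \<in> L \<Longrightarrow> x \<noteq> y \<Longrightarrow> negligible {z. z - x \<in> E \<and> z - y \<in> E}"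
  shows "uniform_discrete L"
proof (rule uniformI1[of 1])
  fix x y assume xy: "x \<in> L" "y \<in> L" "dist x y < 1"
  have "\<bar>x$k - y$k\<bar> < 1" for k
    using component_le_norm_cart[of "x - y" k] xy by (simp add: dist_norm)
  then show "x = y"
    using assms[OF xy(1,2)] not_negligible_overlap[of 1 2 x y] by auto
qed simp

lemma exists_lattice_tiling:
  "\<exists>\<Lambda>. is_lattice \<Lambda> \<and> uniform_discrete \<Lambda> \<and>
     (\<forall>x\<in>\<Lambda>. \<forall>y\<in>\<Lambda>. x \<noteq> y \<longrightarrow> negligible {z. z - x \<in> E \<and> z - y \<in> E}) \<and>
     negligible {z. \<forall>x\<in>\<Lambda>. z - x \<notin> E}"
proof -
  obtain i j :: 2 and t s u where ij: "i \<noteq> j" and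
    T: "t \<in> T" "t + u \<in> T" "t + s \<in> T" "t + (s + u) \<in> T" and
    u: "\<bar>u$i\<bar> \<le> 5*\<epsilon>" "1 \<le> u$j" "u$j \<le> 1 + 3*\<epsilon>" and
    s: "1 \<le> s$i" "s$i \<le> 1 + 3*\<epsilon>" "\<bar>s$j\<bar> \<le> 1/2 + 2*\<epsilon>"
    by (rule parallelogram)
  \<comment> \<open>Column \<open>i\<close> is \<open>s\<close> and column \<open>j\<close> is
    \<open>u\<close>.\<close>
  define A :: "real^2^2" where "A = (\<chi> r c. if c = i then s$r else u$r)"
  have A: "A *v y = y$i *\<^sub>R s + y$j *\<^sub>R u" for y
    unfolding matrix_vector_mult_def UNIV_2_distinct[OF ij]
    using ij by (simp add: A_def vec_eq_iff mult.commute)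
  define \<Lambda> where "\<Lambda> = (\<lambda>v. A *v v) ` {v. \<forall>i. v $ i \<in> \<int>}"
  have mem: "x \<in> \<Lambda> \<longleftrightarrow> (\<exists>(m::int) (n::int). x = m *\<^sub>R s + n *\<^sub>R u)" for x
  proof
    assume "x \<in> \<Lambda>"
    then obtain v where "\<forall>k. v$k \<in> \<int>" "x = v$i *\<^sub>R s + v$j *\<^sub>R u"
      by (auto simp: \<Lambda>_def A)
    then show "\<exists>(m::int) (n::int). x = m *\<^sub>R s + n *\<^sub>R u"
      by (metis Ints_cases)
  next
    assume "\<exists>(m::int) (n::int). x = m *\<^sub>R s + n *\<^sub>R u"
    then obtain m n :: int where mn: "x = m *\<^sub>R s + n *\<^sub>R u" by blast
    define v :: "real^2" where "v = (\<chi> k. if k = i then of_int m else of_int n)"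
    have "x = A *v v"
      using ij by (simp add: A mn v_def)
    moreover have "\<forall>k. v$k \<in> \<int>"
      by (simp add: v_def)
    ultimately show "x \<in> \<Lambda>"
      by (auto simp: \<Lambda>_def)
  qed
  have overlap: "negligible {z. z - x \<in> E \<and> z - y \<in> E}" if xy: "x \<in> \<Lambda>" "y \<in> \<Lambda>" "x \<noteq> y" for x y
  proof -
    obtain m n m' n' :: int where mn: "x = m *\<^sub>R s + n *\<^sub>R u" "y = m' *\<^sub>R s + n' *\<^sub>R u"
      using xy mem by blast
    have d: "y - x = (m' - m) *\<^sub>R s + (n' - n) *\<^sub>R u"
      by (simp add: mn algebra_simps)
    have "(m' - m, n' - n) \<noteq> (0, 0)"
      using xy mn by auto
    then have "negligible {z. z \<in> E \<and> z - (y - x) \<in> E}"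
      using lattice_packing[OF T u(1,2) s(1,3)] unfolding d by blast
    then have "negligible ((+) x ` {z. z \<in> E \<and> z - (y - x) \<in> E})"
      by (rule negligible_translation)
    moreover have "{z. z - x \<in> E \<and> z - y \<in> E} \<subseteq> (+) x ` {z. z \<in> E \<and> z - (y - x) \<in> E}"
    proof
      fix z assume "z \<in> {z. z - x \<in> E \<and> z - y \<in> E}"
      then have "z - x \<in> {z. z \<in> E \<and> z - (y - x) \<in> E}" by simp
      then show "z \<in> (+) x ` {z. z \<in> E \<and> z - (y - x) \<in> E}"
        by (rule rev_image_eqI) simp
    qed
    ultimately show ?thesis
      using negligible_subset by blast
  qed
  have "invertible A"
  proof -
    have "v = 0" if "A *v v = 0" for v
    proof -
      have v: "v$i * s$i + v$j * u$i = 0" "v$i * s$j + v$j * u$j = 0"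
        using that unfolding A vec_eq_iff by auto
      \<comment> \<open>Diagonal dominance again: each of \<open>\<bar>v$i\<bar>\<close>,
        \<open>\<bar>v$j\<bar>\<close> is at most 51/100 of the other.\<close>
      have "\<bar>v$i\<bar> * 1 \<le> \<bar>v$i\<bar> * \<bar>s$i\<bar>" "\<bar>v$j\<bar> * 1 \<le> \<bar>v$j\<bar> * \<bar>u$j\<bar>"
        "\<bar>v$i\<bar> * \<bar>s$j\<bar> \<le> \<bar>v$i\<bar> * (51/100)" "\<bar>v$j\<bar> * \<bar>u$i\<bar> \<le> \<bar>v$j\<bar> * (51/100)"
        using s u eps by (intro mult_left_mono; simp)+
      then have "v$i = 0 \<and> v$j = 0"
        using v unfolding abs_mult[symmetric] by linarith
      then have "\<forall>k. v$k = 0"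
        unfolding all_2_distinct[OF ij] .
      then show "v = 0"
        by (simp add: vec_eq_iff)
    qed
    then show ?thesis
      using invertible_left_inverse matrix_left_invertible_ker by blast
  qed
  then have "is_lattice \<Lambda>"
    unfolding is_lattice_def \<Lambda>_def by blast
  moreover have "negligible {z. \<forall>x\<in>\<Lambda>. z - x \<notin> E}"
    using lattice_covering[OF ij T u s] by (rule negligible_subset) (use mem in blast)
  ultimately show ?thesis
    using overlap uniform_discrete_if_overlaps_negligible[of \<Lambda>] by blast
qed

end

theorem theorem1p2:
  shows "\<exists>\<epsilon>0>0. \<forall>\<epsilon>::real. 0 < \<epsilon> \<and> \<epsilon> < \<epsilon>0 \<longrightarrow>
    (\<forall>E :: (real^2) set.
       E \<in> sets lebesgue \<and> cbox (vec 0) (vec 1) \<subseteq> E \<and>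
       E \<subseteq> cbox (vec (-\<epsilon>)) (vec (1 + \<epsilon>)) \<and> tiles E
       \<longrightarrow> (\<exists>\<Lambda>. is_lattice \<Lambda> \<and> tiles_by E \<Lambda>))"
proof (intro exI[of _ "1/1000"] conjI allI impI)
  fix \<epsilon> :: real and E :: "(real^2) set"
  assume \<epsilon>: "0 < \<epsilon> \<and> \<epsilon> < 1/1000"
    and E: "E \<in> sets lebesgue \<and> cbox (vec 0) (vec 1) \<subseteq> E \<and>
       E \<subseteq> cbox (vec (-\<epsilon>)) (vec (1 + \<epsilon>)) \<and> tiles E"
  then obtain T where T: "tiles_by E T"
    unfolding tiles_def by blast
  have image: "z \<in> (\<lambda>x. x + t) ` E \<longleftrightarrow> z - t \<in> E" for z t
    by (auto intro: rev_image_eqI)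
  have overlap: "(\<lambda>x. x + s) ` E \<inter> (\<lambda>x. x + t) ` E = {z. z - s \<in> E \<and> z - t \<in> E}" for s t
    using image by blast
  have uncovered: "UNIV - (\<Union>t\<in>L. (\<lambda>x. x + t) ` E) = {z. \<forall>t\<in>L. z - t \<notin> E}" for L
    using image by blast
  \<comment> \<open>Turns the translated images in \<open>tiles_by\<close> into the pointwise form
    used by the locale.\<close>
  note tiles_by_iff = tiles_by_def overlap uncovered negligible_iff_null_sets[symmetric]
  interpret near_square_tiling E T \<epsilon>
  proof
    show "0 < \<epsilon>" "\<epsilon> < 1/1000" using \<epsilon> by auto
    show "E \<in> lmeasurable"
      using T by (auto simp: tiles_by_def fmeasurable_def)
    show "x \<in> E" if "\<And>k. 0 \<le> x$k \<and> x$k \<le> 1" for x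
      using E that by (auto simp: subset_iff mem_box_cart)
    show "- \<epsilon> \<le> x$k \<and> x$k \<le> 1 + \<epsilon>" if "x \<in> E" for x k
      using E that by (auto simp: subset_iff mem_box_cart)
    show "negligible {x. x - s \<in> E \<and> x - t \<in> E}" if "s \<in> T" "t \<in> T" "s \<noteq> t" for s t
      using T that unfolding tiles_by_iff by blast
    show "negligible {x. \<forall>t\<in>T. x - t \<notin> E}"
      using T unfolding tiles_by_iff by blast
  qed
  show "\<exists>\<Lambda>. is_lattice \<Lambda> \<and> tiles_by E \<Lambda>"
    using exists_lattice_tiling T uniform_discrete_imp_discrete unfolding tiles_by_iff by blast
qed simp

end
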